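(* Let $L\ge2$ be an integer and $\{\!\{z\}\!\}:=\sinh\big(\frac{\pi z}{L+1}\big)$. The operators, for $a\in\mathbb{Z}+b$, $$T^{\mathrm{hyp}}_A(a)=\frac{\sqrt{\{\!\{a-1\}\!\}\{\!\{a+1\}\!\}}}{\{\!\{a\}\!\}}E_{21}\otimes E_{12}+\frac{\sqrt{\{\!\{a+1\}\!\}\{\!\{a-1\}\!\}}}{\{\!\{a\}\!\}}E_{12}\otimes E_{21}+\frac{\{\!\{a+1\}\!\}}{\{\!\{a\}\!\}}E_{11}\otimes E_{22}+\frac{\{\!\{a-1\}\!\}}{\{\!\{a\}\!\}}E_{22}\otimes E_{11}$$ form a local dynamical Temperley--Lieb operator on $V^{\pi_A^{\mathrm{unres}}}$ associated with the constant function $\bar\kappa^{\mathrm{hyp}}(a)=2\cosh\big(\frac{\pi}{L+1}\big)$.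
   Context: Fix a generic $b\in\mathbb{C}$ (so that $\{\!\{a\}\!\}\ne0$ for all $a\in\mathbb{Z}+b$). $\pi_A^{\mathrm{unres}}$ is the groupoid of the unoriented graph with vertex set $\mathbb{Z}+b$ and one edge between any two neighbouring numbers: its objects are the vertices, each edge gives two mutually inverse arrows, and all arrows are compositions of these. Write $(a,\pm1)$ for the arrow from $a$ to $a\pm1$. $V=V^{\pi_A^{\mathrm{unres}}}$ is the graded vector space with $V_{(a,-1)}=\mathbb{C}e_{(a,-1)}$, $V_{(a,+1)}=\mathbb{C}e_{(a,+1)}$ for all objects $a$, all other components zero. Tensor products: $(V\otimes W)_\gamma=\bigoplus_{\beta\circ\alpha=\gamma}V_\alpha\otimes W_\beta$ ($\beta\circ\alpha$ defined when $t(\alpha)=s(\beta)$, where $s,t$ denote source and target). For each $a$ the source fiber $\bigoplus_{\alpha\in s^{-1}(a)}(V\otimes V)_\alpha$ is identified with $\mathbb{C}^2\otimes\mathbb{C}^2$ by $e_{(a,\varepsilon_1)}\otimes e_{(a+\varepsilon_1,\varepsilon_2)}\mapsto e_{i_1}\otimes e_{i_2}$, with $i=1$ for $\varepsilon=+1$ and $i=2$ for $\varepsilon=-1$; $E_{ij}$ is the $2\times2$ matrix unit, $E_{ij}e_k=\delta_{jk}e_i$. The same square root is used in both off-diagonal entries. For a family $X(a)\in\bigoplus_{\alpha\in s^{-1}(a)}\mathrm{End}_{\mathbb{C}}((V\otimes V)_\alpha)$ and $u\otimes v\otimes w\in V_{\alpha_1}\otimes V_{\alpha_2}\otimes V_{\alpha_3}$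 with composable arrows and $s(\alpha_1)=a$, set $X^{(12)}(a)(u\otimes v\otimes w)=X(a)(u\otimes v)\otimes w$ and $X^{(23)}(ah^{(1)})(u\otimes v\otimes w)=u\otimes X(t(\alpha_1))(v\otimes w)$. A local dynamical Temperley--Lieb operator on $V$ associated to $\bar\kappa:\mathrm{Ob}(\pi)\to\mathbb{C}\setminus\{0\}$ is a family $T(a)\in\bigoplus_{\alpha\in s^{-1}(a)}\mathrm{End}_{\mathbb{C}}((V\otimes V)_\alpha)$ such that for all $a$: $T(a)T(a)=\bar\kappa(a)T(a)$; $T^{(12)}(a)T^{(23)}(ah^{(1)})T^{(12)}(a)=T^{(12)}(a)$; $T^{(23)}(ah^{(1)})T^{(12)}(a)T^{(23)}(ah^{(1)})=T^{(23)}(ah^{(1)})$. *)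

theory Defs
  imports "HOL-Analysis.Analysis"
begin

section \<open>Groupoids and the groupoid of a graph\<close>

text \<open>\<open>Cmp G \<beta> \<alpha>\<close> is \<open>\<beta> \<circ> \<alpha>\<close>: first \<open>\<alpha>\<close>, then \<open>\<beta>\<close>, meaningful when \<open>Tgt G \<alpha> = Src G \<beta>\<close>.\<close>

record ('o, 'm) gpd =
  Ob :: "'o set"
  Arr :: "'m set"
  Src :: "'m \<Rightarrow> 'o"
  Tgt :: "'m \<Rightarrow> 'o"
  Cmp :: "'m \<Rightarrow> 'm \<Rightarrow> 'm"

definition is_groupoid :: "('o, 'm) gpd \<Rightarrow> bool" where
  "is_groupoid G \<longleftrightarrow>
     (\<forall>\<alpha>\<in>Arr G. Src G \<alpha> \<in> Ob G \<and> Tgt G \<alpha> \<in> Ob G) \<and>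
     (\<forall>\<alpha>\<in>Arr G. \<forall>\<beta>\<in>Arr G. Tgt G \<alpha> = Src G \<beta> \<longrightarrow>
        Cmp G \<beta> \<alpha> \<in> Arr G \<and> Src G (Cmp G \<beta> \<alpha>) = Src G \<alpha> \<and> Tgt G (Cmp G \<beta> \<alpha>) = Tgt G \<beta>) \<and>
     (\<forall>\<alpha>\<in>Arr G. \<forall>\<beta>\<in>Arr G. \<forall>\<gamma>\<in>Arr G. Tgt G \<alpha> = Src G \<beta> \<and> Tgt G \<beta> = Src G \<gamma> \<longrightarrow>
        Cmp G \<gamma> (Cmp G \<beta> \<alpha>) = Cmp G (Cmp G \<gamma> \<beta>) \<alpha>) \<and>
     (\<exists>i. (\<forall>a\<in>Ob G. i a \<in> Arr G \<and> Src G (i a) = a \<and> Tgt G (i a) = a) \<and>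
        (\<forall>\<alpha>\<in>Arr G. Cmp G \<alpha> (i (Src G \<alpha>)) = \<alpha> \<and> Cmp G (i (Tgt G \<alpha>)) \<alpha> = \<alpha>) \<and>
        (\<forall>\<alpha>\<in>Arr G. \<exists>\<beta>\<in>Arr G. Src G \<beta> = Tgt G \<alpha> \<and> Tgt G \<beta> = Src G \<alpha> \<and>
           Cmp G \<beta> \<alpha> = i (Src G \<alpha>) \<and> Cmp G \<alpha> \<beta> = i (Tgt G \<alpha>)))"

text \<open>
  A simple graph has vertex set \<open>N\<close> and symmetric adjacency relation \<open>E\<close>; a walk is the nonempty
  list of its vertices. The arrows of its groupoid are the walks modulo insertion and deletion of
  backtrackings \<open>u, v, u\<close>. Hence the two orientations of an edge are mutually inverse, no other
  relations are imposed, and the vertices are the objects.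
\<close>

definition is_walk :: "'v set \<Rightarrow> ('v \<Rightarrow> 'v \<Rightarrow> bool) \<Rightarrow> 'v list \<Rightarrow> bool" where
  "is_walk N E p \<longleftrightarrow> p \<noteq> [] \<and> set p \<subseteq> N \<and> successively E p"

definition backtrack :: "'v set \<Rightarrow> ('v \<Rightarrow> 'v \<Rightarrow> bool) \<Rightarrow> 'v list \<Rightarrow> 'v list \<Rightarrow> bool" where
  "backtrack N E p q \<longleftrightarrow> is_walk N E p \<and> is_walk N E q \<and>
     (\<exists>xs u v ys. p = xs @ [u, v, u] @ ys \<and> q = xs @ [u] @ ys)"

definition walk_class :: "'v set \<Rightarrow> ('v \<Rightarrow> 'v \<Rightarrow> bool) \<Rightarrow> 'v list \<Rightarrow> 'v list set" where
  "walk_class N E p = {q. equivclp (backtrack N E) p q}"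

definition rep :: "'v list set \<Rightarrow> 'v list" where
  "rep A = (SOME p. p \<in> A)"

definition graph_groupoid :: "'v set \<Rightarrow> ('v \<Rightarrow> 'v \<Rightarrow> bool) \<Rightarrow> ('v, 'v list set) gpd" where
  "graph_groupoid N E =
     \<lparr>Ob = N,
      Arr = walk_class N E ` {p. is_walk N E p},
      Src = (\<lambda>A. hd (rep A)),
      Tgt = (\<lambda>A. last (rep A)),
      Cmp = (\<lambda>B A. walk_class N E (rep A @ tl (rep B)))\<rparr>"

lemma backtrack_ends:
  assumes "equivclp (backtrack N E) p q"
  shows "hd p = hd q \<and> last p = last q \<and> (is_walk N E p \<longleftrightarrow> is_walk N E q)"
  using assms
proof (induction rule: equivclp_induct)
  case (step y z)
  have *: "hd y' = hd z' \<and> last y' = last z' \<and> is_walk N E y' \<and> is_walk N E z'"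
    if "backtrack N E y' z'" for y' z'
    using that by (auto simp: backtrack_def hd_append)
  from step show ?case using *[of y z] *[of z y] by auto
qed simp

lemma is_walk_append_tl:
  assumes "is_walk N E p" "is_walk N E q" "last p = hd q"
  shows "is_walk N E (p @ tl q)" "hd (p @ tl q) = hd p" "last (p @ tl q) = last q"
proof -
  obtain x xs where q: "q = x # xs" using assms(2) by (cases q) (auto simp: is_walk_def)
  show "is_walk N E (p @ tl q)" "hd (p @ tl q) = hd p" "last (p @ tl q) = last q"
    using assms q by (auto simp: is_walk_def successively_append_iff successively_Cons)
qed

lemma backtrack_append_tl:
  assumes "backtrack N E p p'" "is_walk N E q" "last p = hd q"
  shows "backtrack N E (p @ tl q) (p' @ tl q)"
proof -
  from assms(1) obtain xs u v ys where w: "is_walk N E p" "is_walk N E p'"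
    and p: "p = xs @ [u, v, u] @ ys" "p' = xs @ [u] @ ys"
    unfolding backtrack_def by blast
  have "last p' = last p" using p by auto
  then have "is_walk N E (p @ tl q)" "is_walk N E (p' @ tl q)"
    using is_walk_append_tl(1) w assms by metis+
  moreover have "p @ tl q = xs @ [u, v, u] @ (ys @ tl q)" "p' @ tl q = xs @ [u] @ (ys @ tl q)"
    using p by auto
  ultimately show ?thesis unfolding backtrack_def by blast
qed

lemma tl_append_backtrack:
  assumes "backtrack N E q q'" "is_walk N E p" "last p = hd q"
  shows "backtrack N E (p @ tl q) (p @ tl q')"
proof -
  from assms(1) obtain xs u v ys where w: "is_walk N E q" "is_walk N E q'"
    and q: "q = xs @ [u, v, u] @ ys" "q' = xs @ [u] @ ys"
    unfolding backtrack_def by blast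
  have "hd q' = hd q" using q by (cases xs) auto
  then have W: "is_walk N E (p @ tl q)" "is_walk N E (p @ tl q')"
    using is_walk_append_tl(1) w assms by metis+
  have "\<exists>zs. p @ tl q = zs @ [u, v, u] @ ys \<and> p @ tl q' = zs @ [u] @ ys"
  proof (cases xs)
    case Nil
    then have "last p = u" "p \<noteq> []" using assms(2,3) q by (auto simp: is_walk_def)
    then obtain p0 where "p = p0 @ [u]" by (metis append_butlast_last_id)
    then show ?thesis using Nil q by (intro exI[of _ p0]) simp
  next
    case (Cons x xs')
    then show ?thesis using q by (intro exI[of _ "p @ xs'"]) auto
  qed
  with W show ?thesis unfolding backtrack_def by blast
qed

lemma equivclp_map:
  assumes "equivclp R p q" "P p" "\<And>x y. R x y \<Longrightarrow> P x \<longleftrightarrow> P y"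
    "\<And>x y. R x y \<Longrightarrow> P x \<Longrightarrow> S (f x) (f y)"
  shows "equivclp S (f p) (f q) \<and> P q"
  using assms(1)
proof (induction rule: equivclp_induct)
  case base
  show ?case using assms(2) by simp
next
  case (step y z)
  from step(2) have "P z" "S (f y) (f z) \<or> S (f z) (f y)" using step(3) assms(3,4) by blast+
  with step(3) show ?case by (meson equivclp_into_equivclp)
qed

lemma equivclp_append_tl:
  assumes p: "equivclp (backtrack N E) p p'" and q: "equivclp (backtrack N E) q q'"
    and w: "is_walk N E p" "is_walk N E q" "last p = hd q"
  shows "equivclp (backtrack N E) (p @ tl q) (p' @ tl q')"
proof -
  have ends: "(hd x = hd y \<and> last x = last y) \<and> is_walk N E x \<and> is_walk N E y" if "backtrack N E x y" for x y
    using backtrack_ends[of N E x y] that r_into_equivclp[of "backtrack N E" x y]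
    by (auto simp: backtrack_def)
  have 1: "equivclp (backtrack N E) (p @ tl q) (p' @ tl q) \<and> last p' = hd q"
    by (rule equivclp_map[OF p, where P = "\<lambda>x. last x = hd q"])
       (use w(2,3) in \<open>auto simp: ends intro: backtrack_append_tl dest: ends\<close>)
  have w': "is_walk N E p'" using backtrack_ends[OF p] w by auto
  have 2: "equivclp (backtrack N E) (p' @ tl q) (p' @ tl q') \<and> last p' = hd q'"
    by (rule equivclp_map[OF q, where P = "\<lambda>x. last p' = hd x"])
       (use w' 1 in \<open>auto simp: ends intro: tl_append_backtrack dest: ends\<close>)
  from 1 2 show ?thesis using equivclp_trans by metis
qed

lemma walk_class_eq: "walk_class N E p = walk_class N E q \<longleftrightarrow> equivclp (backtrack N E) p q"
  unfolding walk_class_def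
  by (metis (no_types, lifting) Collect_cong equivclp_refl equivclp_sym equivclp_trans mem_Collect_eq)

lemma rep_walk_class: "equivclp (backtrack N E) p (rep (walk_class N E p))"
proof -
  have "p \<in> walk_class N E p" by (simp add: walk_class_def)
  then have "rep (walk_class N E p) \<in> walk_class N E p" unfolding rep_def by (rule someI)
  then show ?thesis by (simp add: walk_class_def)
qed

lemma graph_groupoid_simps:
  shows "Ob (graph_groupoid N E) = N"
    and "Arr (graph_groupoid N E) = walk_class N E ` {p. is_walk N E p}"
    and "Src (graph_groupoid N E) (walk_class N E p) = hd p"
    and "Tgt (graph_groupoid N E) (walk_class N E p) = last p"
  using backtrack_ends[OF rep_walk_class[of N E p]] by (simp_all add: graph_groupoid_def)

lemma graph_groupoid_Cmp:
  assumes "is_walk N E p" "is_walk N E q" "last p = hd q"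
  shows "Cmp (graph_groupoid N E) (walk_class N E q) (walk_class N E p) = walk_class N E (p @ tl q)"
  using equivclp_append_tl[OF rep_walk_class rep_walk_class assms]
  by (simp add: graph_groupoid_def walk_class_eq equivclp_sym)

lemma walk_rev_cancel:
  assumes "symp E" "is_walk N E p"
  shows "is_walk N E (rev p) \<and> equivclp (backtrack N E) (p @ tl (rev p)) [hd p]"
  using assms(2)
proof (induction p)
  case Nil
  then show ?case by (simp add: is_walk_def)
next
  case (Cons x p)
  show ?case
  proof (cases p)
    case Nil
    then show ?thesis using Cons by (simp add: is_walk_def)
  next
    case (Cons y ys)
    have x: "x \<in> N" "E x y" "E y x" and wp: "is_walk N E p"
      using Cons.prems assms(1) \<open>p = y # ys\<close>
      by (auto simp: is_walk_def successively_Cons dest: sympD)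
    from Cons.IH wp have r: "is_walk N E (rev p)"
      and e: "equivclp (backtrack N E) (p @ tl (rev p)) [y]" using \<open>p = y # ys\<close> by auto
    have y: "y \<in> N" using wp \<open>p = y # ys\<close> by (auto simp: is_walk_def)
    have yx: "is_walk N E [y, x]" and xy: "is_walk N E [x, y]" using x y by (auto simp: is_walk_def)
    have "is_walk N E (rev p @ tl [y, x])"
      by (rule is_walk_append_tl(1)[OF r yx]) (simp add: \<open>p = y # ys\<close>)
    then have 1: "is_walk N E (rev (x # p))" by simp
    have pr: "is_walk N E (p @ tl (rev p))" "last (p @ tl (rev p)) = y" "hd (p @ tl (rev p)) = y"
      using is_walk_append_tl[OF wp r] wp \<open>p = y # ys\<close> by (auto simp: is_walk_def hd_rev last_rev)
    have "equivclp (backtrack N E) ((p @ tl (rev p)) @ tl [y, x]) ([y] @ tl [y, x])"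
      by (rule equivclp_append_tl[OF e _ pr(1) yx]) (use pr in auto)
    moreover have "is_walk N E ((p @ tl (rev p)) @ tl [y, x])" "hd ((p @ tl (rev p)) @ tl [y, x]) = y"
      using is_walk_append_tl[OF pr(1) yx] pr by auto
    ultimately have "equivclp (backtrack N E) ([x, y] @ tl ((p @ tl (rev p)) @ tl [y, x])) ([x, y] @ tl ([y] @ tl [y, x]))"
      by (intro equivclp_append_tl[OF equivclp_refl _ xy]) simp_all
    moreover have "[x, y] @ tl ((p @ tl (rev p)) @ tl [y, x]) = (x # p) @ tl (rev (x # p))"
      using \<open>p = y # ys\<close> by (cases "rev ys") auto
    moreover have "backtrack N E ([x, y] @ tl ([y] @ tl [y, x])) [x]"
      unfolding backtrack_def using x y
      by (auto simp: is_walk_def intro!: exI[of _ "[]"])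
    ultimately have "equivclp (backtrack N E) ((x # p) @ tl (rev (x # p))) [x]"
      by (metis equivclp_trans r_into_equivclp)
    with 1 show ?thesis by simp
  qed
qed

lemma graph_groupoid_is_groupoid:
  assumes "symp E"
  shows "is_groupoid (graph_groupoid N E)"
proof -
  let ?G = "graph_groupoid N E" and ?c = "walk_class N E"
  note [simp] = graph_groupoid_simps graph_groupoid_Cmp
  have ne: "p \<noteq> []" "hd p \<in> N" "last p \<in> N" if "is_walk N E p" for p
    using that by (auto simp: is_walk_def)
  have pt: "is_walk N E [a]" if "a \<in> N" for a using that by (simp add: is_walk_def)
  have inv: "\<exists>q. is_walk N E q \<and> hd q = last p \<and> last q = hd p \<and>
      ?c (p @ tl q) = ?c [hd p] \<and> ?c (q @ tl p) = ?c [last p]" if p: "is_walk N E p" for p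
    using walk_rev_cancel[OF assms p] walk_rev_cancel[OF assms, of N "rev p"] ne[OF p]
    by (intro exI[of _ "rev p"]) (auto simp: walk_class_eq hd_rev last_rev)
  have id: "[hd p] @ tl p = p" if "is_walk N E p" for p using ne(1)[OF that] by simp
  have closed: "\<forall>\<alpha>\<in>Arr ?G. \<forall>\<beta>\<in>Arr ?G. Tgt ?G \<alpha> = Src ?G \<beta> \<longrightarrow>
        Cmp ?G \<beta> \<alpha> \<in> Arr ?G \<and> Src ?G (Cmp ?G \<beta> \<alpha>) = Src ?G \<alpha> \<and> Tgt ?G (Cmp ?G \<beta> \<alpha>) = Tgt ?G \<beta>"
    using is_walk_append_tl[of N E] by auto
  have assoc: "\<forall>\<alpha>\<in>Arr ?G. \<forall>\<beta>\<in>Arr ?G. \<forall>\<gamma>\<in>Arr ?G. Tgt ?G \<alpha> = Src ?G \<beta> \<and> Tgt ?G \<beta> = Src ?G \<gamma> \<longrightarrow>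
        Cmp ?G \<gamma> (Cmp ?G \<beta> \<alpha>) = Cmp ?G (Cmp ?G \<gamma> \<beta>) \<alpha>"
    using is_walk_append_tl[of N E] ne(1) by auto
  have units: "(\<forall>a\<in>N. ?c [a] \<in> Arr ?G \<and> Src ?G (?c [a]) = a \<and> Tgt ?G (?c [a]) = a) \<and>
        (\<forall>\<alpha>\<in>Arr ?G. Cmp ?G \<alpha> (?c [Src ?G \<alpha>]) = \<alpha> \<and> Cmp ?G (?c [Tgt ?G \<alpha>]) \<alpha> = \<alpha>)"
  proof (intro conjI ballI)
    fix \<alpha> assume "\<alpha> \<in> Arr ?G"
    then obtain p where p: "is_walk N E p" "\<alpha> = ?c p" by auto
    show "Cmp ?G \<alpha> (?c [Src ?G \<alpha>]) = \<alpha>"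
      using graph_groupoid_Cmp[OF pt[OF ne(2)[OF p(1)]] p(1)] id[OF p(1)] p by simp
    show "Cmp ?G (?c [Tgt ?G \<alpha>]) \<alpha> = \<alpha>"
      using graph_groupoid_Cmp[OF p(1) pt[OF ne(3)[OF p(1)]]] p by simp
  qed (use pt in auto)
  have inverses: "\<forall>\<alpha>\<in>Arr ?G. \<exists>\<beta>\<in>Arr ?G. Src ?G \<beta> = Tgt ?G \<alpha> \<and> Tgt ?G \<beta> = Src ?G \<alpha> \<and>
           Cmp ?G \<beta> \<alpha> = ?c [Src ?G \<alpha>] \<and> Cmp ?G \<alpha> \<beta> = ?c [Tgt ?G \<alpha>]"
  proof
    fix \<alpha> assume "\<alpha> \<in> Arr ?G"
    then obtain p where p: "is_walk N E p" "\<alpha> = ?c p" by auto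
    from inv[OF p(1)] obtain q where q: "is_walk N E q" "hd q = last p" "last q = hd p"
      "?c (p @ tl q) = ?c [hd p]" "?c (q @ tl p) = ?c [last p]" by blast
    show "\<exists>\<beta>\<in>Arr ?G. Src ?G \<beta> = Tgt ?G \<alpha> \<and> Tgt ?G \<beta> = Src ?G \<alpha> \<and>
           Cmp ?G \<beta> \<alpha> = ?c [Src ?G \<alpha>] \<and> Cmp ?G \<alpha> \<beta> = ?c [Tgt ?G \<alpha>]"
      using p q by (intro bexI[of _ "?c q"]) auto
  qed
  have ends: "\<forall>\<alpha>\<in>Arr ?G. Src ?G \<alpha> \<in> Ob ?G \<and> Tgt ?G \<alpha> \<in> Ob ?G" using ne by auto
  show ?thesis unfolding is_groupoid_def
    unfolding graph_groupoid_simps(1)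
    by (intro conjI exI[of _ "\<lambda>a. ?c [a]"])
      (fact ends[unfolded graph_groupoid_simps(1)] closed assoc units[THEN conjunct1]
        units[THEN conjunct2] inverses)+
qed


section \<open>Graded vector spaces over a groupoid\<close>

text \<open>
  A complex vector space graded by the arrows of a groupoid is given by a homogeneous basis
  (indexed by \<open>basis V\<close>, with degrees \<open>deg V\<close>). Its vectors are the finitely supported coefficient
  functions on the basis. The tensor product over a groupoid has the basis
  \<open>e\<^sub>x \<otimes> e\<^sub>y\<close> with \<open>deg x\<close> and \<open>deg y\<close> composable.
\<close>

record ('x, 'm) graded =
  basis :: "'x set"
  deg :: "'x \<Rightarrow> 'm"

definition component :: "('x, 'm) graded \<Rightarrow> 'm \<Rightarrow> ('x \<Rightarrow> complex) set" where
  "component V \<gamma> = {f. finite {x. f x \<noteq> 0} \<and> (\<forall>x. f x \<noteq> 0 \<longrightarrow> x \<in> basis V \<and> deg V x = \<gamma>)}"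

definition source_fiber ::
    "('o, 'm) gpd \<Rightarrow> ('x, 'm) graded \<Rightarrow> 'o \<Rightarrow> ('x \<Rightarrow> complex) set" where
  "source_fiber G V a =
     {f. finite {x. f x \<noteq> 0} \<and> (\<forall>x. f x \<noteq> 0 \<longrightarrow> x \<in> basis V \<and> Src G (deg V x) = a)}"

definition tensor ::
    "('o, 'm) gpd \<Rightarrow> ('x, 'm) graded \<Rightarrow> ('y, 'm) graded \<Rightarrow> ('x \<times> 'y, 'm) graded" where
  "tensor G V W =
     \<lparr>basis = {(x, y). x \<in> basis V \<and> y \<in> basis W \<and> Tgt G (deg V x) = Src G (deg W y)},
      deg = (\<lambda>(x, y). Cmp G (deg W y) (deg V x))\<rparr>"

definition pure :: "('x \<Rightarrow> complex) \<Rightarrow> ('y \<Rightarrow> complex) \<Rightarrow> 'x \<times> 'y \<Rightarrow> complex" where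
  "pure u v = (\<lambda>(x, y). u x * v y)"

definition linear_on_fiber ::
    "('o, 'm) gpd \<Rightarrow> ('x, 'm) graded \<Rightarrow> 'o \<Rightarrow> (('x \<Rightarrow> complex) \<Rightarrow> 'x \<Rightarrow> complex) \<Rightarrow> bool" where
  "linear_on_fiber G W a X \<longleftrightarrow>
     (\<forall>f\<in>source_fiber G W a. \<forall>g\<in>source_fiber G W a. X (\<lambda>x. f x + g x) = (\<lambda>x. X f x + X g x)) \<and>
     (\<forall>f\<in>source_fiber G W a. \<forall>c. X (\<lambda>x. c * f x) = (\<lambda>x. c * X f x))"

text \<open>
  \<open>X(a) \<in> \<Oplus>\<^bsub>\<alpha> \<in> s\<^sup>-\<^sup>1(a)\<^esub> End(W\<^sub>\<alpha>)\<close> for all objects \<open>a\<close>, as a linear map on the source fiber preserving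
  all homogeneous components and vanishing on all but finitely many of them. Only the values of
  \<open>X(a)\<close> on the source fiber at \<open>a\<close> matter.
\<close>

definition local_endomorphisms ::
    "('o, 'm) gpd \<Rightarrow> ('x, 'm) graded \<Rightarrow> ('o \<Rightarrow> ('x \<Rightarrow> complex) \<Rightarrow> 'x \<Rightarrow> complex) \<Rightarrow> bool" where
  "local_endomorphisms G W X \<longleftrightarrow>
     (\<forall>a\<in>Ob G. linear_on_fiber G W a (X a) \<and>
        (\<forall>\<alpha>\<in>Arr G. Src G \<alpha> = a \<longrightarrow> (\<forall>f\<in>component W \<alpha>. X a f \<in> component W \<alpha>)) \<and>
        finite {\<alpha> \<in> Arr G. Src G \<alpha> = a \<and> (\<exists>f\<in>component W \<alpha>. X a f \<noteq> (\<lambda>x. 0))})"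

text \<open>Vectors of \<open>V \<otimes> V \<otimes> V\<close> are functions on index triples \<open>((x, y), z)\<close>.\<close>

definition op12 ::
    "('o \<Rightarrow> ('x \<times> 'x \<Rightarrow> complex) \<Rightarrow> 'x \<times> 'x \<Rightarrow> complex) \<Rightarrow> 'o \<Rightarrow>
     (('x \<times> 'x) \<times> 'x \<Rightarrow> complex) \<Rightarrow> ('x \<times> 'x) \<times> 'x \<Rightarrow> complex" where
  "op12 X a f = (\<lambda>(p, z). X a (\<lambda>p'. f (p', z)) p)"

text \<open>The argument \<open>a\<close> of \<open>op23\<close> does not occur on the right: on the source fiber at \<open>a\<close>,
  \<open>X\<close> is evaluated at the target of the first arrow.\<close>

definition op23 ::
    "('o, 'm) gpd \<Rightarrow> ('x, 'm) graded \<Rightarrow>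
     ('o \<Rightarrow> ('x \<times> 'x \<Rightarrow> complex) \<Rightarrow> 'x \<times> 'x \<Rightarrow> complex) \<Rightarrow> 'o \<Rightarrow>
     (('x \<times> 'x) \<times> 'x \<Rightarrow> complex) \<Rightarrow> ('x \<times> 'x) \<times> 'x \<Rightarrow> complex" where
  "op23 G V X a f = (\<lambda>((x, y), z).
     if x \<in> basis V then X (Tgt G (deg V x)) (\<lambda>(y', z'). f ((x, y'), z')) (y, z) else 0)"

lemma pure_in_component:
  assumes "u \<in> component V \<alpha>" "v \<in> component W \<beta>" "Tgt G \<alpha> = Src G \<beta>"
  shows "pure u v \<in> component (tensor G V W) (Cmp G \<beta> \<alpha>)"
proof -
  have "finite ({x. u x \<noteq> 0} \<times> {y. v y \<noteq> 0})" using assms by (simp add: component_def)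
  moreover have "{p. pure u v p \<noteq> 0} = {x. u x \<noteq> 0} \<times> {y. v y \<noteq> 0}" by (auto simp: pure_def)
  ultimately show ?thesis using assms by (auto simp: component_def tensor_def pure_def)
qed

lemma linear_on_fiber_zero: "linear_on_fiber G W a X \<Longrightarrow> X (\<lambda>_. 0) = (\<lambda>_. 0)"
proof -
  assume "linear_on_fiber G W a X"
  then have "\<forall>f\<in>source_fiber G W a. \<forall>c. X (\<lambda>x. c * f x) = (\<lambda>x. c * X f x)"
    by (simp add: linear_on_fiber_def)
  moreover have "(\<lambda>_. 0) \<in> source_fiber G W a" by (simp add: source_fiber_def)
  ultimately have "\<forall>c. X (\<lambda>x. c * 0) = (\<lambda>x. c * X (\<lambda>_. 0) x)" by (rule bspec)
  from spec[OF this, of 0] show ?thesis by simp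
qed

lemma component_in_fiber: "f \<in> component V \<gamma> \<Longrightarrow> f \<in> source_fiber G V (Src G \<gamma>)"
  by (auto simp: component_def source_fiber_def)

lemma
  assumes G: "is_groupoid G"
    and X: "local_endomorphisms G (tensor G V V) X"
    and V: "\<And>x. x \<in> basis V \<Longrightarrow> deg V x \<in> Arr G"
    and arr: "\<alpha>1 \<in> Arr G" "\<alpha>2 \<in> Arr G" "\<alpha>3 \<in> Arr G"
    and comp: "Src G \<alpha>1 = a" "Tgt G \<alpha>1 = Src G \<alpha>2" "Tgt G \<alpha>2 = Src G \<alpha>3"
    and uvw: "u \<in> component V \<alpha>1" "v \<in> component V \<alpha>2" "w \<in> component V \<alpha>3"
  shows op12_pure: "op12 X a (pure (pure u v) w) = pure (X a (pure u v)) w"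
    and op23_pure: "op23 G V X a (pure (pure u v) w) =
      (\<lambda>((x, y), z). pure u (X (Tgt G \<alpha>1) (pure v w)) (x, (y, z)))"
proof -
  have ob: "a \<in> Ob G" "Tgt G \<alpha>1 \<in> Ob G" using G arr comp unfolding is_groupoid_def by blast+
  have "Src G (Cmp G \<alpha>2 \<alpha>1) = a" "Src G (Cmp G \<alpha>3 \<alpha>2) = Tgt G \<alpha>1"
    using G arr comp unfolding is_groupoid_def by metis+
  with component_in_fiber[OF pure_in_component[OF uvw(1,2) comp(2)], of G]
    component_in_fiber[OF pure_in_component[OF uvw(2,3) comp(3)], of G]
  have f: "pure u v \<in> source_fiber G (tensor G V V) a"
    "pure v w \<in> source_fiber G (tensor G V V) (Tgt G \<alpha>1)" by simp_all
  have lin: "X a (\<lambda>x. c * pure u v x) = (\<lambda>x. c * X a (pure u v) x)"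
    "X (Tgt G \<alpha>1) (\<lambda>x. c * pure v w x) = (\<lambda>x. c * X (Tgt G \<alpha>1) (pure v w) x)" for c
    using X ob f unfolding local_endomorphisms_def linear_on_fiber_def by blast+
  show "op12 X a (pure (pure u v) w) = pure (X a (pure u v)) w"
  proof
    fix q :: "('c \<times> 'c) \<times> 'c"
    obtain p z where q: "q = (p, z)" by (cases q)
    have "(\<lambda>p'. pure (pure u v) w (p', z)) = (\<lambda>p'. w z * pure u v p')"
      by (simp add: pure_def[of _ w] mult.commute)
    then show "op12 X a (pure (pure u v) w) q = pure (X a (pure u v)) w q"
      by (simp add: op12_def q lin pure_def[of _ w])
  qed
  show "op23 G V X a (pure (pure u v) w) =
      (\<lambda>((x, y), z). pure u (X (Tgt G \<alpha>1) (pure v w)) (x, (y, z)))"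
  proof
    fix q :: "('c \<times> 'c) \<times> 'c"
    obtain x y z where q: "q = ((x, y), z)" by (metis surj_pair)
    have *: "(\<lambda>(y', z'). pure (pure u v) w ((x, y'), z')) = (\<lambda>p. u x * pure v w p)"
      by (auto simp: pure_def)
    show "op23 G V X a (pure (pure u v) w) q =
      (\<lambda>((x, y), z). pure u (X (Tgt G \<alpha>1) (pure v w)) (x, (y, z))) q"
    proof (cases "u x = 0")
      case False
      then have "x \<in> basis V" "deg V x = \<alpha>1" using uvw(1) by (auto simp: component_def)
      then show ?thesis by (simp only: q op23_def * lin prod.case if_True
          pure_def[of u "X (Tgt G \<alpha>1) (pure v w)"])
    next
      case True
      have "X (Tgt G (deg V x)) (\<lambda>_. 0) = (\<lambda>_. 0)" if "x \<in> basis V"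
      proof -
        have "Tgt G (deg V x) \<in> Ob G" using G V[OF that] by (simp add: is_groupoid_def)
        then have "linear_on_fiber G (tensor G V V) (Tgt G (deg V x)) (X (Tgt G (deg V x)))"
          using X by (simp add: local_endomorphisms_def)
        then show ?thesis by (rule linear_on_fiber_zero)
      qed
      then show ?thesis
        by (cases "x \<in> basis V") (simp_all only: q op23_def * prod.case if_True if_False
          pure_def[of u "X (Tgt G \<alpha>1) (pure v w)"] True mult_zero_left)
    qed
  qed
qed


section \<open>Local dynamical Temperley--Lieb operators\<close>

definition local_dynamical_TL ::
    "('o, 'm) gpd \<Rightarrow> ('x, 'm) graded \<Rightarrow> ('o \<Rightarrow> complex) \<Rightarrow>
     ('o \<Rightarrow> ('x \<times> 'x \<Rightarrow> complex) \<Rightarrow> 'x \<times> 'x \<Rightarrow> complex) \<Rightarrow> bool" where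
  "local_dynamical_TL G V \<kappa> T \<longleftrightarrow>
     (\<forall>a\<in>Ob G. \<kappa> a \<noteq> 0) \<and>
     local_endomorphisms G (tensor G V V) T \<and>
     (\<forall>a\<in>Ob G.
        (\<forall>f\<in>source_fiber G (tensor G V V) a. T a (T a f) = (\<lambda>p. \<kappa> a * T a f p)) \<and>
        (\<forall>f\<in>source_fiber G (tensor G (tensor G V V) V) a.
           op12 T a (op23 G V T a (op12 T a f)) = op12 T a f \<and>
           op23 G V T a (op12 T a (op23 G V T a f)) = op23 G V T a f))"


section \<open>The unrestricted groupoid of type A and its vector space\<close>

definition piA :: "complex \<Rightarrow> (complex, complex list set) gpd" where
  "piA b = graph_groupoid {of_int n + b | n. True} (\<lambda>x y. y = x + 1 \<or> y = x - 1)"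

text \<open>The arrow \<open>(a, \<epsilon>)\<close>, \<open>\<epsilon> = \<plusminus>1\<close>, from \<open>a\<close> to \<open>a + \<epsilon>\<close>.\<close>

definition edge :: "complex \<Rightarrow> complex \<times> int \<Rightarrow> complex list set" where
  "edge b = (\<lambda>(a, \<epsilon>). walk_class {of_int n + b | n. True} (\<lambda>x y. y = x + 1 \<or> y = x - 1) [a, a + of_int \<epsilon>])"

definition VA :: "complex \<Rightarrow> (complex \<times> int, complex list set) graded" where
  "VA b = \<lparr>basis = Ob (piA b) \<times> {1, -1}, deg = edge b\<rparr>"

lemma piA_is_groupoid: "is_groupoid (piA b)"
  unfolding piA_def by (rule graph_groupoid_is_groupoid) (auto intro: sympI)


section \<open>The hyperbolic operator\<close>

definition eps :: "2 \<Rightarrow> int" where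
  "eps i = (if i = 1 then 1 else -1)"

definition path_index :: "complex \<Rightarrow> 2 \<times> 2 \<Rightarrow> (complex \<times> int) \<times> (complex \<times> int)" where
  "path_index a = (\<lambda>(i, j). ((a, eps i), (a + of_int (eps i), eps j)))"

text \<open>
  The identification of the source fiber at \<open>a\<close> with \<open>\<complex>\<^sup>2 \<otimes> \<complex>\<^sup>2\<close>, i.e. with coordinate vectors
  indexed by pairs \<open>(i, j)\<close> for the basis \<open>e\<^sub>i \<otimes> e\<^sub>j\<close>, and its inverse.
\<close>

definition to_C2C2 :: "complex \<Rightarrow> ((complex \<times> int) \<times> (complex \<times> int) \<Rightarrow> complex) \<Rightarrow> complex^(2 \<times> 2)" where
  "to_C2C2 a f = (\<chi> p. f (path_index a p))"

definition of_C2C2 :: "complex \<Rightarrow> complex^(2 \<times> 2) \<Rightarrow> (complex \<times> int) \<times> (complex \<times> int) \<Rightarrow> complex" where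
  "of_C2C2 a v = (\<lambda>k. \<Sum>p\<in>UNIV. v $ p * (if k = path_index a p then 1 else 0))"

lemma eps_eq_iff: "eps i = eps j \<longleftrightarrow> i = j"
  using exhaust_2[of i] exhaust_2[of j] by (auto simp: eps_def)

lemma path_index_eq_iff: "path_index a p = path_index a q \<longleftrightarrow> p = q"
  by (cases p; cases q) (auto simp: path_index_def eps_eq_iff)

lemma to_of_C2C2: "to_C2C2 a (of_C2C2 a v) = v"
  by (simp add: to_C2C2_def of_C2C2_def path_index_eq_iff vec_eq_iff if_distrib cong: if_cong)

definition matrix_unit :: "2 \<Rightarrow> 2 \<Rightarrow> complex^2^2" where
  "matrix_unit i j = (\<chi> k l. if k = i \<and> l = j then 1 else 0)"

definition kron :: "complex^2^2 \<Rightarrow> complex^2^2 \<Rightarrow> complex^(2 \<times> 2)^(2 \<times> 2)" where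
  "kron A B = (\<chi> p q. A $ fst p $ fst q * B $ snd p $ snd q)"

definition mscale :: "complex \<Rightarrow> complex^'n^'m \<Rightarrow> complex^'n^'m" where
  "mscale c M = (\<chi> i j. c * M $ i $ j)"

definition brace :: "nat \<Rightarrow> complex \<Rightarrow> complex" where
  "brace L z = sinh (of_real pi * z / of_nat (L + 1))"

text \<open>\<open>r a\<close> is the chosen square root of \<open>brace L (a - 1) * brace L (a + 1)\<close>.\<close>

definition T_hyp_matrix :: "nat \<Rightarrow> (complex \<Rightarrow> complex) \<Rightarrow> complex \<Rightarrow> complex^(2 \<times> 2)^(2 \<times> 2)" where
  "T_hyp_matrix L r a =
     mscale (r a / brace L a) (kron (matrix_unit 2 1) (matrix_unit 1 2)) +
     mscale (r a / brace L a) (kron (matrix_unit 1 2) (matrix_unit 2 1)) +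
     mscale (brace L (a + 1) / brace L a) (kron (matrix_unit 1 1) (matrix_unit 2 2)) +
     mscale (brace L (a - 1) / brace L a) (kron (matrix_unit 2 2) (matrix_unit 1 1))"

definition T_hyp ::
    "nat \<Rightarrow> (complex \<Rightarrow> complex) \<Rightarrow> complex \<Rightarrow>
     ((complex \<times> int) \<times> (complex \<times> int) \<Rightarrow> complex) \<Rightarrow> (complex \<times> int) \<times> (complex \<times> int) \<Rightarrow> complex" where
  "T_hyp L r a f = of_C2C2 a (T_hyp_matrix L r a *v to_C2C2 a f)"

end

theory Submission
  imports Defs
begin

text \<open>
  A two-step path \<open>(a, \<epsilon>), (a + \<epsilon>, \<epsilon>')\<close> on the line returns to \<open>a\<close> exactly when \<open>\<epsilon>' = - \<epsilon>\<close>. The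
  operator in question annihilates the two straight paths and acts on the two loops at \<open>a\<close> by a
  \<open>2 \<times> 2\<close> matrix \<open>W a\<close>, with rows and columns indexed by the first step \<open>\<plusminus>1\<close>. Three properties of
  these matrices give all the relations:
  \<^item> \<open>W a\<close> has rank one; this is where \<open>(r a)\<^sup>2 = brace L (a - 1) * brace L (a + 1)\<close> enters, as the
    vanishing of the determinant;
  \<^item> its trace is \<open>\<kappa>\<close>, by the addition theorem for \<open>sinh\<close>; a rank one matrix satisfies
    \<open>W a\<^sup>2 = tr (W a) * W a\<close>, hence the quadratic relation;
  \<^item> \<open>W a e e * W (a + e) (- e) (- e) = 1\<close>, since these two entries are the mutually inverse
    quotients of \<open>brace L (a + e)\<close> and \<open>brace L a\<close>.

  For the cubic relations, follow a three-step path through \<open>T\<^sup>1\<^sup>2 T\<^sup>2\<^sup>3 T\<^sup>1\<^sup>2\<close>. After the first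
  \<open>T\<^sup>1\<^sup>2\<close> the path begins with a loop, and if its last step is \<open>d\<close>, then \<open>T\<^sup>2\<^sup>3\<close> and the second
  \<open>T\<^sup>1\<^sup>2\<close> only see the zigzag \<open>d, - d, d\<close>. There is thus a single intermediate path, and the matrix
  entry from \<open>e'\<close> to \<open>e\<close> is \<open>W a e d * W (a + d) (- d) (- d) * W a d e'\<close>. Rank one turns it into
  \<open>W a d d * W (a + d) (- d) (- d) * W a e e'\<close>, and the first two factors cancel. The other
  relation is the same computation with the roles of \<open>a\<close> and \<open>a + d\<close> exchanged.

  The lemma \<open>loop_op_TL\<close> carries this out for arbitrary \<open>W\<close>, and \<open>T_hyp_eq_loop_op\<close> identifies the
  hyperbolic operator as an instance.
\<close>

section \<open>Loops of length two on the line\<close>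

definition loop :: "complex \<Rightarrow> int \<Rightarrow> (complex \<times> int) \<times> (complex \<times> int)" where
  "loop a e = ((a, e), (a + of_int e, - e))"

definition loop_op ::
    "(complex \<Rightarrow> int \<Rightarrow> int \<Rightarrow> complex) \<Rightarrow> complex \<Rightarrow>
     ((complex \<times> int) \<times> (complex \<times> int) \<Rightarrow> complex) \<Rightarrow> (complex \<times> int) \<times> (complex \<times> int) \<Rightarrow> complex" where
  "loop_op W a f = (\<lambda>k. \<Sum>e\<in>{1, -1}. if k = loop a e then \<Sum>d\<in>{1, -1}. W a e d * f (loop a d) else 0)"

lemma loop_eq_iff [simp]: "loop a e = loop c d \<longleftrightarrow> a = c \<and> e = d"
  by (auto simp: loop_def)

lemma loop_op_loop:
  "e \<in> {1, -1} \<Longrightarrow> loop_op W a f (loop a e) = W a e 1 * f (loop a 1) + W a e (-1) * f (loop a (-1))"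
  by (auto simp: loop_op_def)

lemma loop_op_other: "k \<notin> loop a ` {1, -1} \<Longrightarrow> loop_op W a f k = 0"
  by (simp add: loop_op_def)

lemma loop_op_nonzeroE:
  assumes "loop_op W a f k \<noteq> 0"
  obtains e d where "e \<in> {1, -1}" "k = loop a e" "d \<in> {1, -1}" "f (loop a d) \<noteq> 0"
proof -
  obtain e where e: "e \<in> {1, -1}" "k = loop a e" using assms loop_op_other[of k a W f] by auto
  have "W a e 1 * f (loop a 1) + W a e (-1) * f (loop a (-1)) \<noteq> 0"
    using assms loop_op_loop[OF e(1), of W a f] e(2) by metis
  then have "f (loop a 1) \<noteq> 0 \<or> f (loop a (-1)) \<noteq> 0" by auto
  with e that show thesis by blast
qed


section \<open>The graded space and its tensor powers\<close>

lemma Ob_piA: "Ob (piA b) = {of_int n + b | n. True}"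
  by (simp add: piA_def graph_groupoid_simps)

lemma Ob_piA_step: "a \<in> Ob (piA b) \<Longrightarrow> a + of_int e \<in> Ob (piA b)"
proof -
  assume "a \<in> Ob (piA b)"
  then obtain n where "a = of_int n + b" by (auto simp: Ob_piA)
  then have "a + of_int e = of_int (n + e) + b" by simp
  then show ?thesis unfolding Ob_piA by blast
qed

lemma Src_edge [simp]: "Src (piA b) (edge b x) = fst x"
  and Tgt_edge [simp]: "Tgt (piA b) (edge b x) = fst x + of_int (snd x)"
  by (simp_all add: piA_def edge_def graph_groupoid_simps split: prod.split)

lemma VA_simps [simp]: "basis (VA b) = Ob (piA b) \<times> {1, -1}" "deg (VA b) = edge b"
  by (simp_all add: VA_def)

lemma edge_in_Arr: "x \<in> Ob (piA b) \<times> {1, -1} \<Longrightarrow> edge b x \<in> Arr (piA b)"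
  using Ob_piA_step[of "fst x" b "snd x"]
  by (cases x) (auto simp: edge_def piA_def graph_groupoid_simps is_walk_def)

lemma groupoid_Src_Cmp:
  "is_groupoid G \<Longrightarrow> \<alpha> \<in> Arr G \<Longrightarrow> \<beta> \<in> Arr G \<Longrightarrow> Tgt G \<alpha> = Src G \<beta> \<Longrightarrow>
    Src G (Cmp G \<beta> \<alpha>) = Src G \<alpha> \<and> Tgt G (Cmp G \<beta> \<alpha>) = Tgt G \<beta> \<and> Cmp G \<beta> \<alpha> \<in> Arr G"
  unfolding is_groupoid_def by blast

lemma loop_in_basis:
  "a \<in> Ob (piA b) \<Longrightarrow> e \<in> {1, -1} \<Longrightarrow> loop a e \<in> basis (tensor (piA b) (VA b) (VA b))"
  using Ob_piA_step[of a b e] by (auto simp: tensor_def loop_def)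

text \<open>
  Both loops have the identity at \<open>a\<close> as their degree, because a step followed by its reverse is a
  backtrack. Operators mixing the two loops therefore preserve the grading.
\<close>

lemma deg_loop:
  assumes "a \<in> Ob (piA b)" "e \<in> {1, -1}"
  shows "deg (tensor (piA b) (VA b) (VA b)) (loop a e) =
    walk_class (Ob (piA b)) (\<lambda>x y. y = x + 1 \<or> y = x - 1) [a]"
proof -
  let ?N = "Ob (piA b)" and ?E = "\<lambda>x y :: complex. y = x + 1 \<or> y = x - 1"
  have n: "a + of_int e \<in> ?N" using assms Ob_piA_step by blast
  have w: "is_walk ?N ?E [a, a + of_int e]" "is_walk ?N ?E [a + of_int e, a]"
    "is_walk ?N ?E [a, a + of_int e, a]" "is_walk ?N ?E [a]"
    using assms n by (auto simp: is_walk_def)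
  have "deg (tensor (piA b) (VA b) (VA b)) (loop a e) =
    Cmp (graph_groupoid ?N ?E) (walk_class ?N ?E [a + of_int e, a]) (walk_class ?N ?E [a, a + of_int e])"
    by (simp add: tensor_def loop_def edge_def Ob_piA[symmetric]) (simp add: piA_def graph_groupoid_simps)
  also have "\<dots> = walk_class ?N ?E ([a, a + of_int e] @ tl [a + of_int e, a])"
    by (rule graph_groupoid_Cmp) (use w in auto)
  also have "\<dots> = walk_class ?N ?E [a]"
    unfolding walk_class_eq
    by (rule r_into_equivclp) (use w in \<open>auto simp: backtrack_def intro!: exI[of _ "[]"]\<close>)
  finally show ?thesis .
qed

lemma triple_fiber_nonzero:
  assumes f: "f \<in> source_fiber (piA b) (tensor (piA b) (tensor (piA b) (VA b) (VA b)) (VA b)) a"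
    and nz: "f ((x, y), z) \<noteq> 0"
  shows "fst x = a" "snd x \<in> {1, -1}" "fst y = a + of_int (snd x)" "snd y \<in> {1, -1}"
    "fst z = a + of_int (snd x) + of_int (snd y)" "snd z \<in> {1, -1}"
proof -
  let ?V3 = "tensor (piA b) (tensor (piA b) (VA b) (VA b)) (VA b)"
  have B: "((x, y), z) \<in> basis ?V3 \<and> Src (piA b) (deg ?V3 ((x, y), z)) = a"
    using f nz unfolding source_fiber_def by blast
  have *: "x \<in> Ob (piA b) \<times> {1, -1}" "y \<in> Ob (piA b) \<times> {1, -1}" "z \<in> Ob (piA b) \<times> {1, -1}"
    "fst x + of_int (snd x) = fst y" "Tgt (piA b) (Cmp (piA b) (edge b y) (edge b x)) = fst z"
    "Src (piA b) (Cmp (piA b) (edge b z) (Cmp (piA b) (edge b y) (edge b x))) = a"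
    using B by (auto simp: tensor_def)
  note C = groupoid_Src_Cmp[OF piA_is_groupoid edge_in_Arr[OF *(1)] edge_in_Arr[OF *(2)]]
  have t: "fst y + of_int (snd y) = fst z" using C * by simp
  have "fst x = a"
    using groupoid_Src_Cmp[OF piA_is_groupoid _ edge_in_Arr[OF *(3)], of "Cmp (piA b) (edge b y) (edge b x)"] C *
    by simp
  with * t show "fst x = a" "snd x \<in> {1, -1}" "fst y = a + of_int (snd x)" "snd y \<in> {1, -1}"
    "fst z = a + of_int (snd x) + of_int (snd y)" "snd z \<in> {1, -1}" by (auto simp: mem_Times_iff)
qed


section \<open>Temperley--Lieb relations for weights on loops\<close>

lemma loop_op_local_endomorphisms:
  "local_endomorphisms (piA b) (tensor (piA b) (VA b) (VA b)) (loop_op W)"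
  unfolding local_endomorphisms_def
proof (intro ballI conjI impI)
  fix a assume a: "a \<in> Ob (piA b)"
  let ?V = "tensor (piA b) (VA b) (VA b)"
  let ?i = "walk_class (Ob (piA b)) (\<lambda>x y. y = x + 1 \<or> y = x - 1) [a]"
  show "linear_on_fiber (piA b) ?V a (loop_op W a)"
    by (auto simp: linear_on_fiber_def loop_op_def fun_eq_iff algebra_simps)
  have deg: "\<alpha> = ?i" if "f \<in> component ?V \<alpha>" "loop_op W a f k \<noteq> 0" for f \<alpha> k
    using that(2)
  proof (rule loop_op_nonzeroE)
    fix d assume "d \<in> {1, -1}" "f (loop a d) \<noteq> 0"
    with that(1) have "deg ?V (loop a d) = \<alpha>" unfolding component_def by blast
    with deg_loop[OF a \<open>d \<in> {1, -1}\<close>] show ?thesis by simp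
  qed
  show "loop_op W a f \<in> component ?V \<alpha>" if f: "f \<in> component ?V \<alpha>" for f \<alpha>
  proof -
    have "finite {k. loop_op W a f k \<noteq> 0}"
      by (rule finite_subset[of _ "loop a ` {1, -1}"]) (auto elim: loop_op_nonzeroE)
    moreover have "k \<in> basis ?V \<and> deg ?V k = \<alpha>" if nz: "loop_op W a f k \<noteq> 0" for k
      using nz
    proof (rule loop_op_nonzeroE)
      fix e assume "e \<in> {1, -1}" "k = loop a e"
      then show ?thesis using loop_in_basis[OF a] deg_loop[OF a] deg[OF f nz] by metis
    qed
    ultimately show ?thesis by (simp add: component_def)
  qed
  show "finite {\<alpha> \<in> Arr (piA b). Src (piA b) \<alpha> = a \<and> (\<exists>f\<in>component ?V \<alpha>. loop_op W a f \<noteq> (\<lambda>x. 0))}"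
    by (rule finite_subset[of _ "{?i}"]) (use deg in \<open>auto simp: fun_eq_iff\<close>)
qed

lemma op12_loop_op_loop:
  "e \<in> {1, -1} \<Longrightarrow> op12 (loop_op W) a f (loop a e, z) =
    W a e 1 * f (loop a 1, z) + W a e (-1) * f (loop a (-1), z)"
  by (simp add: op12_def loop_op_loop)

lemma op12_loop_op_other:
  "p \<notin> loop a ` {1, -1} \<Longrightarrow> op12 (loop_op W) a f (p, z) = 0"
  by (simp add: op12_def loop_op_other)

lemma op23_loop_op_loop:
  assumes "c \<in> Ob (piA b)" "d \<in> {1, -1}" "e \<in> {1, -1}"
  shows "op23 (piA b) (VA b) (loop_op W) a f (((c, d), (c + of_int d, e)), (c + of_int d + of_int e, - e)) =
    W (c + of_int d) e 1 * f (((c, d), (c + of_int d, 1)), (c + of_int d + 1, -1)) +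
    W (c + of_int d) e (-1) * f (((c, d), (c + of_int d, -1)), (c + of_int d - 1, 1))"
  using loop_op_loop[OF assms(3), of W "c + of_int d" "\<lambda>(y, z). f (((c, d), y), z)"] assms
  by (simp add: op23_def loop_def)

lemma op23_loop_op_other:
  assumes "(y, z) \<notin> loop (fst x + of_int (snd x)) ` {1, -1}"
  shows "op23 (piA b) (VA b) (loop_op W) a f ((x, y), z) = 0"
  using loop_op_other[of "(y, z)" "fst x + of_int (snd x)" W] assms by (simp add: op23_def)

text \<open>
  A path \<open>loop a d\<close> followed by a step \<open>z\<close> ends in a loop at \<open>a + d\<close> if and only if \<open>z = (a, d)\<close>.
  So for a given last step at most one of the paths \<open>loop a 1, z\<close> and \<open>loop a (- 1), z\<close> survives
  \<open>T\<^sup>2\<^sup>3\<close>, and of its image only the diagonal entry begins with a loop again.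
\<close>

lemma op12_op23_op12:
  assumes a: "a \<in> Ob (piA b)"
    and rank_one: "\<And>e d d'. e \<in> {1, -1} \<Longrightarrow> d \<in> {1, -1} \<Longrightarrow> d' \<in> {1, -1} \<Longrightarrow>
      W a e d * W a d d' = W a d d * W a e d'"
    and inverse: "\<And>e. e \<in> {1, -1} \<Longrightarrow> W a e e * W (a + of_int e) (- e) (- e) = 1"
    and f: "f \<in> source_fiber (piA b) (tensor (piA b) (tensor (piA b) (VA b) (VA b)) (VA b)) a"
  shows "op12 (loop_op W) a (op23 (piA b) (VA b) (loop_op W) a (op12 (loop_op W) a f)) = op12 (loop_op W) a f"
proof
  let ?T12 = "op12 (loop_op W) a" and ?T23 = "op23 (piA b) (VA b) (loop_op W) a"
  let ?h = "?T12 f"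
  fix k :: "((complex \<times> int) \<times> (complex \<times> int)) \<times> (complex \<times> int)"
  obtain p z where k: "k = (p, z)" by (cases k)
  show "?T12 (?T23 ?h) k = ?h k"
  proof (cases "\<exists>e\<in>{1, -1}. p = loop a e")
    case False
    then show ?thesis using k by (auto simp: op12_loop_op_other)
  next
    case True
    then obtain e where e: "e \<in> {1, -1}" "p = loop a e" by blast
    have off: "?T23 ?h (loop a d, z) = 0" if "z \<noteq> (a, d)" for d
      unfolding loop_def by (rule op23_loop_op_other) (use that in \<open>auto simp: loop_def\<close>)
    have straight: "?h (((a, d), (a + of_int d, d)), z') = 0" if "d \<in> {1, -1}" for d z'
      by (rule op12_loop_op_other) (use that in \<open>auto simp: loop_def\<close>)
    have on: "?T23 ?h (loop a d, (a, d)) = W (a + of_int d) (- d) (- d) * ?h (loop a d, (a, d))"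
      if "d \<in> {1, -1}" for d
      using op23_loop_op_loop[OF a that, of "- d" W a ?h] that straight[OF that]
      by (auto simp: loop_def)
    show ?thesis
    proof (cases "\<exists>d\<in>{1, -1}. z = (a, d)")
      case True
      then obtain d where d: "d \<in> {1, -1}" "z = (a, d)" by blast
      have "?T12 (?T23 ?h) k = W a e d * ?T23 ?h (loop a d, z)"
        using op12_loop_op_loop[OF e(1), of W a "?T23 ?h" z] off[of 1] off[of "-1"] d k e(2) by auto
      also have "\<dots> = W (a + of_int d) (- d) (- d) *
        (W a e d * W a d 1 * f (loop a 1, z) + W a e d * W a d (-1) * f (loop a (-1), z))"
        using on[OF d(1)] d op12_loop_op_loop[OF d(1), of W a f z] by (simp add: algebra_simps)
      also have "\<dots> = (W a d d * W (a + of_int d) (- d) (- d)) *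
        (W a e 1 * f (loop a 1, z) + W a e (-1) * f (loop a (-1), z))"
        using rank_one[OF e(1) d(1), of 1] rank_one[OF e(1) d(1), of "-1"] by (simp add: algebra_simps)
      also have "\<dots> = ?h k"
        using inverse[OF d(1)] op12_loop_op_loop[OF e(1), of W a f z] k e(2) by simp
      finally show ?thesis .
    next
      case False
      \<comment> \<open>In the fiber over \<open>a\<close> the last step after a loop starts at \<open>a\<close>, so it is one of \<open>(a, 1)\<close> and \<open>(a, -1)\<close>.\<close>
      then have "f (loop a d, z) = 0" for d
        using triple_fiber_nonzero[OF f, of "(a, d)" "(a + of_int d, - d)" z]
        by (cases z) (auto simp: loop_def)
      then have "?h k = 0" using k e op12_loop_op_loop[OF e(1), of W a f z] by simp
      moreover have "?T12 (?T23 ?h) k = 0"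
        using op12_loop_op_loop[OF e(1), of W a "?T23 ?h" z] off[of 1] off[of "-1"] False k e(2) by auto
      ultimately show ?thesis by simp
    qed
  qed
qed

text \<open>
  The mirror image: now the first step \<open>(a, d)\<close> is fixed, and of the paths continuing it by a loop at
  \<open>a + d\<close> only the zigzag \<open>d, - d, d\<close> begins with a loop at \<open>a\<close>. The rank one property is used
  at \<open>a + d\<close> instead of \<open>a\<close>.
\<close>

lemma op23_op12_op23:
  assumes a: "a \<in> Ob (piA b)"
    and rank_one: "\<And>c e d d'. c \<in> Ob (piA b) \<Longrightarrow> e \<in> {1, -1} \<Longrightarrow> d \<in> {1, -1} \<Longrightarrow> d' \<in> {1, -1} \<Longrightarrow>
      W c e d * W c d d' = W c d d * W c e d'"
    and inverse: "\<And>e. e \<in> {1, -1} \<Longrightarrow> W a e e * W (a + of_int e) (- e) (- e) = 1"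
    and f: "f \<in> source_fiber (piA b) (tensor (piA b) (tensor (piA b) (VA b) (VA b)) (VA b)) a"
  shows "op23 (piA b) (VA b) (loop_op W) a (op12 (loop_op W) a (op23 (piA b) (VA b) (loop_op W) a f)) =
    op23 (piA b) (VA b) (loop_op W) a f"
proof
  let ?T12 = "op12 (loop_op W) a" and ?T23 = "op23 (piA b) (VA b) (loop_op W) a"
  let ?h = "?T23 f"
  fix k :: "((complex \<times> int) \<times> (complex \<times> int)) \<times> (complex \<times> int)"
  obtain x y z where k: "k = ((x, y), z)" by (metis surj_pair)
  obtain c d where x: "x = (c, d)" by (cases x)
  let ?c = "c + of_int d"
  show "?T23 (?T12 ?h) k = ?h k"
  proof (cases "x \<in> basis (VA b) \<and> (\<exists>e\<in>{1, -1}. (y, z) = loop ?c e)")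
    case False
    then consider "x \<notin> basis (VA b)" | "(y, z) \<notin> loop (fst x + of_int (snd x)) ` {1, -1}"
      using x by auto
    then show ?thesis
    proof cases
      case 1
      then show ?thesis unfolding k op23_def prod.case by simp
    next
      case 2
      then show ?thesis unfolding k by (simp only: op23_loop_op_other not_False_eq_True)
    qed
  next
    case True
    then obtain e where e: "e \<in> {1, -1}" "y = (?c, e)" "z = (?c + of_int e, - e)"
      by (auto simp: loop_def)
    have c: "c \<in> Ob (piA b)" and d: "d \<in> {1, -1}" using True x by auto
    have k': "k = (((c, d), (?c, e)), (?c + of_int e, - e))" using k x e by simp
    note T23 = op23_loop_op_loop[OF c d, of _ W a]
    show ?thesis
    proof (cases "c = a")
      case False
      have "f (((c, d), y'), z') = 0" for y' z'
        using triple_fiber_nonzero(1)[OF f] False by fastforce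
      then have "?h k = 0" using T23[OF e(1), of f] k' by simp
      moreover have "?T12 ?h (((c, d), y'), z') = 0" for y' z'
        by (rule op12_loop_op_other) (use False in \<open>auto simp: loop_def\<close>)
      then have "?T23 (?T12 ?h) k = 0" using T23[OF e(1), of "?T12 ?h"] k' by simp
      ultimately show ?thesis by simp
    next
      case True
      let ?u = "f (((a, d), (?c, 1)), (?c + 1, -1))" and ?v = "f (((a, d), (?c, -1)), (?c - 1, 1))"
      have md: "- d \<in> {1, -1}" using d by auto
      have straight: "?T12 ?h (((a, d), (a + of_int d, d)), z') = 0" for z'
        by (rule op12_loop_op_other) (use d in \<open>auto simp: loop_def\<close>)
      \<comment> \<open>The path with steps \<open>- d, d, d\<close> has straight last two steps, so it is not in the image of \<open>T\<^sup>2\<^sup>3\<close>.\<close>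
      have off: "?h (loop a (- d), (a, d)) = 0"
        unfolding loop_def by (rule op23_loop_op_other) (use d in \<open>auto simp: loop_def\<close>)
      have on: "?T12 ?h (loop a d, (a, d)) = W a d d * ?h (loop a d, (a, d))"
        using op12_loop_op_loop[OF d, of W a ?h "(a, d)"] off d by auto
      have h: "?h (loop a d, (a, d)) = W ?c (- d) 1 * ?u + W ?c (- d) (-1) * ?v"
        using T23[OF md, of f] True by (simp add: loop_def)
      have "?T23 (?T12 ?h) k = W ?c e (- d) * ?T12 ?h (loop a d, (a, d))"
        using T23[OF e(1), of "?T12 ?h"] k' True straight d by (auto simp: loop_def)
      also have "\<dots> = W a d d * (W ?c e (- d) * W ?c (- d) 1 * ?u + W ?c e (- d) * W ?c (- d) (-1) * ?v)"
        unfolding on h by (simp add: algebra_simps)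
      also have "\<dots> = (W a d d * W ?c (- d) (- d)) * (W ?c e 1 * ?u + W ?c e (-1) * ?v)"
        using rank_one[OF Ob_piA_step[OF c, of d] e(1) md, of 1]
          rank_one[OF Ob_piA_step[OF c, of d] e(1) md, of "-1"] by (simp add: algebra_simps)
      also have "\<dots> = ?h k"
        using inverse[OF d] T23[OF e(1), of f] k' True by simp
      finally show ?thesis .
    qed
  qed
qed

text \<open>
  The rank one hypothesis is trivial unless \<open>d\<close> differs from both \<open>e\<close> and \<open>d'\<close>, when it says that the
  determinant of \<open>W a\<close> vanishes. Summed over \<open>d\<close>, it is the equation \<open>W a\<^sup>2 = tr (W a) * W a\<close>.
\<close>

lemma loop_op_TL:
  assumes rank_one: "\<And>a e d d'. a \<in> Ob (piA b) \<Longrightarrow> e \<in> {1, -1} \<Longrightarrow> d \<in> {1, -1} \<Longrightarrow> d' \<in> {1, -1} \<Longrightarrow>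
      W a e d * W a d d' = W a d d * W a e d'"
    and inverse: "\<And>a e. a \<in> Ob (piA b) \<Longrightarrow> e \<in> {1, -1} \<Longrightarrow> W a e e * W (a + of_int e) (- e) (- e) = 1"
    and trace: "\<And>a. a \<in> Ob (piA b) \<Longrightarrow> W a 1 1 + W a (-1) (-1) = \<kappa> a"
    and nonzero: "\<And>a. a \<in> Ob (piA b) \<Longrightarrow> \<kappa> a \<noteq> 0"
  shows "local_dynamical_TL (piA b) (VA b) \<kappa> (loop_op W)"
proof -
  have "loop_op W a (loop_op W a f) = (\<lambda>k. \<kappa> a * loop_op W a f k)" if a: "a \<in> Ob (piA b)" for a f
  proof
    fix k
    show "loop_op W a (loop_op W a f) k = \<kappa> a * loop_op W a f k"
    proof (cases "\<exists>e\<in>{1, -1}. k = loop a e")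
      case True
      then obtain e where e: "e \<in> {1, -1}" "k = loop a e" by blast
      let ?u = "f (loop a 1)" and ?v = "f (loop a (-1))"
      have "loop_op W a (loop_op W a f) k =
        (W a e 1 * W a 1 1) * ?u + (W a e 1 * W a 1 (-1)) * ?v +
        (W a e (-1) * W a (-1) 1) * ?u + (W a e (-1) * W a (-1) (-1)) * ?v"
        unfolding e(2) loop_op_loop[OF e(1)] by (simp add: loop_op_loop algebra_simps)
      also have "\<dots> = (W a 1 1 + W a (-1) (-1)) * (W a e 1 * ?u + W a e (-1) * ?v)"
        using rank_one[OF a e(1), of 1 1] rank_one[OF a e(1), of 1 "-1"]
          rank_one[OF a e(1), of "-1" 1] rank_one[OF a e(1), of "-1" "-1"] by (simp add: algebra_simps)
      also have "\<dots> = \<kappa> a * loop_op W a f k"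
        unfolding e(2) loop_op_loop[OF e(1)] trace[OF a] ..
      finally show ?thesis .
    next
      case False
      then show ?thesis by (auto simp: loop_op_other)
    qed
  qed
  then show ?thesis
    unfolding local_dynamical_TL_def
    by (intro conjI ballI nonzero loop_op_local_endomorphisms op12_op23_op12 op23_op12_op23)
      (use rank_one inverse in simp_all)
qed


section \<open>The hyperbolic weights\<close>

definition hyp_weight :: "nat \<Rightarrow> (complex \<Rightarrow> complex) \<Rightarrow> complex \<Rightarrow> int \<Rightarrow> int \<Rightarrow> complex" where
  "hyp_weight L r a e d = (if e = d then brace L (a + of_int e) else r a) / brace L a"

lemma path_index_loop: "path_index a (1, 2) = loop a 1" "path_index a (2, 1) = loop a (-1)"
  by (simp_all add: path_index_def loop_def eps_def)

lemma T_hyp_eq_loop_op: "T_hyp L r = loop_op (hyp_weight L r)"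
proof (intro ext)
  fix a f k
  let ?M = "T_hyp_matrix L r a" and ?w = "hyp_weight L r a"
  have U: "(UNIV :: (2 \<times> 2) set) = {(1, 1), (1, 2), (2, 1), (2, 2)}"
    using exhaust_2 by auto
  have sum4: "(\<Sum>p\<in>UNIV. g p) = g (1, 1) + g (1, 2) + g (2, 1) + g (2, 2)" for g :: "2 \<times> 2 \<Rightarrow> complex"
    unfolding U by simp
  have M: "?M $ (1, 2) $ q = (if q = (1, 2) then ?w 1 1 else if q = (2, 1) then ?w 1 (-1) else 0)"
    "?M $ (2, 1) $ q = (if q = (2, 1) then ?w (-1) (-1) else if q = (1, 2) then ?w (-1) 1 else 0)"
    "?M $ (1, 1) $ q = 0" "?M $ (2, 2) $ q = 0" for q
    by (cases q; auto simp: T_hyp_matrix_def mscale_def kron_def matrix_unit_def hyp_weight_def)+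
  have v: "(?M *v to_C2C2 a f) $ (1, 1) = 0" "(?M *v to_C2C2 a f) $ (2, 2) = 0"
    "(?M *v to_C2C2 a f) $ (1, 2) = ?w 1 1 * f (loop a 1) + ?w 1 (-1) * f (loop a (-1))"
    "(?M *v to_C2C2 a f) $ (2, 1) = ?w (-1) 1 * f (loop a 1) + ?w (-1) (-1) * f (loop a (-1))"
    by (simp_all add: matrix_vector_mult_def sum4 M to_C2C2_def path_index_loop)
  show "T_hyp L r a f k = loop_op (hyp_weight L r) a f k"
    by (simp add: T_hyp_def of_C2C2_def sum4 v path_index_loop loop_op_def)
qed

lemma brace_add_brace:
  "brace L (a + 1) + brace L (a - 1) = 2 * cosh (of_real pi / of_nat (L + 1)) * brace L a"
proof -
  define x y where "x = of_real pi * a / of_nat (L + 1)" and "y = (of_real pi / of_nat (L + 1) :: complex)"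
  have "brace L (a + 1) = sinh (x + y)" "brace L (a - 1) = sinh (x - y)"
    by (simp_all add: brace_def x_def y_def add_divide_distrib diff_divide_distrib algebra_simps)
  moreover have "sinh (x + y) + sinh (x - y) = 2 * cosh y * sinh x"
    by (simp add: sinh_add sinh_diff)
  ultimately show ?thesis by (simp add: brace_def x_def y_def)
qed

theorem proposition2p28:
  fixes L :: nat and b :: complex and r :: "complex \<Rightarrow> complex"
  assumes "L \<ge> 2"
    and generic: "\<And>a. a \<in> Ob (piA b) \<Longrightarrow> brace L a \<noteq> 0"
    and root: "\<And>a. a \<in> Ob (piA b) \<Longrightarrow> (r a)\<^sup>2 = brace L (a - 1) * brace L (a + 1)"
  shows "local_dynamical_TL (piA b) (VA b)
    (\<lambda>a. 2 * cosh (of_real pi / of_nat (L + 1))) (T_hyp L r)"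
  unfolding T_hyp_eq_loop_op
proof (rule loop_op_TL)
  fix a and e d d' :: int
  assume a: "a \<in> Ob (piA b)" and e: "e \<in> {1, -1}" "d \<in> {1, -1}" "d' \<in> {1 :: int, -1}"
  show "hyp_weight L r a e d * hyp_weight L r a d d' = hyp_weight L r a d d * hyp_weight L r a e d'"
    using e root[OF a] by (auto simp: hyp_weight_def power2_eq_square mult.commute)
next
  fix a and e :: int
  assume a: "a \<in> Ob (piA b)"
  show "hyp_weight L r a e e * hyp_weight L r (a + of_int e) (- e) (- e) = 1"
    using generic[OF a] generic[OF Ob_piA_step[OF a, of e]] by (simp add: hyp_weight_def)
next
  fix a assume a: "a \<in> Ob (piA b)"
  show "hyp_weight L r a 1 1 + hyp_weight L r a (-1) (-1) = 2 * cosh (of_real pi / of_nat (L + 1))"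
    using generic[OF a] brace_add_brace[of L a]
    by (simp add: hyp_weight_def add_divide_distrib[symmetric])
next
  have "cosh (of_real x) = (of_real (cosh x) :: complex)" for x
    by (simp add: cosh_def scaleR_conv_of_real exp_of_real flip: of_real_minus)
  from this[of "pi / real (L + 1)"]
  have "cosh (of_real pi / of_nat (L + 1)) = (of_real (cosh (pi / real (L + 1))) :: complex)"
    by (simp only: of_real_divide of_real_of_nat_eq)
  moreover have "cosh (pi / real (L + 1)) \<noteq> 0" by (simp add: cosh_real_nonzero)
  ultimately show "2 * cosh (of_real pi / of_nat (L + 1)) \<noteq> (0 :: complex)"
    by (simp only: mult_eq_0_iff of_real_eq_0_iff) simp
qed

end
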